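(* Let $A=\{0,1\}$. For every $\delta>0$ there exists a family $(P_n)_{n\in\mathbb N}$, where each $P_n$ is a probability distribution on $A^n$ with Shannon entropy $h(P_n)\ge n-1$, such that the following holds: for every family of stegosystems $(\mathrm{St}_n)_{n\in\mathbb N}$ whose Kolmogorov complexity satisfies $\log K(\mathrm{St}_n)=o(n)$ as $n\to\infty$ and whose speed of transmission of hidden text (computed with respect to the covertext source $P_n$) satisfies $v_n(\mathrm{St}_n)\ge\delta$, the stegosystem $\mathrm{St}_n$ is not perfectly secure for the covertext source $P_n$ for all sufficiently large $n$.
   Context: Covertexts are words over the alphabet $A=\{0,1\}$. A source of secret text $\omega$ generates an infinite sequence $y^*=y_1y_2\dots$ with $y_i\in\{0,1\}$ independent and $\omega(y_i=0)=\omega(y_i=1)=1/2$ for all $i$. A source of covertexts is a probability distribution $\mu$ on $A^n$; the covertext $x$ is drawn from $\mu$ independently of $y^*$. A stegosystem $\mathrm{St}_n$ (for length $n$) is a pair of functions: an encoder that maps each pair $(x,y^* )\in A^n\times\{0,1\}^\infty$ to a pair $(t,\mathrm{StEnc}_n(x,y_1\dots y_t))\in\mathbb N\times A^n$, where $t=t(x,y^* )\ge 0$ is the number of secret bits transmitted and $\mathrm{StEnc}_n(x,y_1\dots y_t)\in A^n$ is the output covertext sent over the public channel (only this output, not $t$, is sent); and a decoder $\mathrm{StDec}_n:A^n\to\{0,1\}^*$, with decoding always correct: $\mathrm{StDec}_n(\mathrm{StEnc}_n(x,y_1\dots y_t))=y_1\dots y_t$. The stegosystem is perfectly secure for $\mu$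 if $\Pr_{\mu\times\omega}(\mathrm{StEnc}_n(x,y_1\dots y_{t(x,y^* )})=x')=\mu(x')$ for every $x'\in A^n$. The speed of transmission of secret text is $v_n(\mathrm{St}_n)=\mathbf E_{\mu\times\omega}[t(x,y^* )]/n$. The Shannon entropy is $h(\mu)=-\sum_{x\in A^n}\mu(x)\log_2\mu(x)$. $K(\cdot)$ denotes (prefix-free or plain, up to additive constants) Kolmogorov complexity with respect to a fixed universal machine; $K(\mathrm{St}_n)$ is the length of a shortest program describing (computing) the encoder and decoder of $\mathrm{St}_n$. Logarithms are base 2. *)

theory Defs
  imports "HOL-Probability.Probability" "HOL-Library.Landau_Symbols"
begin

section \<open>Partial recursive functionals and Kolmogorov complexity\<close>

text \<open>Kleene's partial recursive functions relative to an infinite binary sequence \<open>y\<close>, the same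
  scheme being applied to every \<open>y\<close>. \<open>None\<close> stands for divergence. Arguments are passed as lists;
  a function is undefined when arguments are missing, and superfluous arguments are ignored.\<close>

inductive partial_recursive :: "(bool stream \<Rightarrow> nat list \<Rightarrow> nat option) \<Rightarrow> bool" where
  zero: "partial_recursive (\<lambda>y xs. Some 0)"
| succ: "partial_recursive (\<lambda>y xs. case xs of [] \<Rightarrow> None | x # _ \<Rightarrow> Some (Suc x))"
| proj: "partial_recursive (\<lambda>y xs. if i < length xs then Some (xs ! i) else None)"
| query: "partial_recursive
    (\<lambda>y xs. case xs of [] \<Rightarrow> None | x # _ \<Rightarrow> Some (if y !! x then 1 else 0))"
| comp: "\<lbrakk>partial_recursive f; \<forall>g\<in>set gs. partial_recursive g\<rbrakk> \<Longrightarrow>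
    partial_recursive (\<lambda>y xs. Option.bind (those (map (\<lambda>g. g y xs) gs)) (f y))"
| prec: "\<lbrakk>partial_recursive f; partial_recursive g\<rbrakk> \<Longrightarrow>
    partial_recursive (\<lambda>y xs. case xs of [] \<Rightarrow> None
      | k # zs \<Rightarrow> rec_nat (f y zs) (\<lambda>i r. Option.bind r (\<lambda>v. g y (i # v # zs))) k)"
| mu: "partial_recursive f \<Longrightarrow>
    partial_recursive (\<lambda>y xs.
      if \<exists>k. f y (k # xs) = Some 0 \<and> (\<forall>j<k. \<exists>v. f y (j # xs) = Some (Suc v))
      then Some (LEAST k. f y (k # xs) = Some 0) else None)"

text \<open>The bijection between binary words and natural numbers given by bijective base 2.\<close>

fun word_code :: "bool list \<Rightarrow> nat" where
  "word_code [] = 0"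
| "word_code (b # w) = 2 * word_code w + (if b then 2 else 1)"

text \<open>A machine receives a program, a finite input word, and read access to an infinite binary
  sequence.\<close>

type_synonym machine = "bool list \<Rightarrow> bool list \<Rightarrow> bool stream \<Rightarrow> bool list option"

definition computable_machine :: "machine \<Rightarrow> bool" where
  "computable_machine M \<longleftrightarrow> (\<exists>\<phi>. partial_recursive \<phi> \<and>
     (\<forall>p u y. map_option word_code (M p u y) = \<phi> y [word_code p, word_code u]))"

definition universal_machine :: "machine \<Rightarrow> bool" where
  "universal_machine U \<longleftrightarrow> computable_machine U \<and>
     (\<forall>M. computable_machine M \<longrightarrow> (\<exists>w. \<forall>p u y. U (w @ p) u y = M p u y))"


section \<open>Stegosystems\<close>

definition words :: "nat \<Rightarrow> bool list set" where
  "words n = {x. length x = n}"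

definition secret_source :: "bool stream measure" where
  "secret_source = stream_space (measure_pmf (bernoulli_pmf (1/2)))"

text \<open>\<open>nbits x y\<close> is the number \<open>t(x, y)\<close> of transmitted bits; \<open>enc\<close> only gets to see the first
  \<open>t(x, y)\<close> bits of the secret text.\<close>

record stegosystem =
  nbits :: "bool list \<Rightarrow> bool stream \<Rightarrow> nat"
  enc :: "bool list \<Rightarrow> bool list \<Rightarrow> bool list"
  dec :: "bool list \<Rightarrow> bool list"

definition sent_bits :: "stegosystem \<Rightarrow> bool list \<Rightarrow> bool stream \<Rightarrow> bool list" where
  "sent_bits St x y = stake (nbits St x y) y"

definition stego_output :: "stegosystem \<Rightarrow> bool list \<Rightarrow> bool stream \<Rightarrow> bool list" where
  "stego_output St x y = enc St x (sent_bits St x y)"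

text \<open>Measurability makes \<open>t\<close> a random variable. It is required for all \<open>x\<close>, not just for words of
  length \<open>n\<close>, so that irrelevant values of \<open>nbits\<close> cannot destroy measurability on the product
  space.\<close>

definition is_stegosystem :: "nat \<Rightarrow> stegosystem \<Rightarrow> bool" where
  "is_stegosystem n St \<longleftrightarrow>
     (\<forall>x. nbits St x \<in> measurable secret_source (count_space UNIV)) \<and>
     (\<forall>x\<in>words n. \<forall>y. stego_output St x y \<in> words n \<and> dec St (stego_output St x y) = sent_bits St x y)"

definition perfectly_secure :: "nat \<Rightarrow> bool list pmf \<Rightarrow> stegosystem \<Rightarrow> bool" where
  "perfectly_secure n \<mu> St \<longleftrightarrow> (\<forall>x'\<in>words n.
     measure (measure_pmf \<mu> \<Otimes>\<^sub>M secret_source) {(x, y). stego_output St x y = x'} = pmf \<mu> x')"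

definition speed :: "nat \<Rightarrow> bool list pmf \<Rightarrow> stegosystem \<Rightarrow> real" where
  "speed n \<mu> St =
     (LINT (x, y)|(measure_pmf \<mu> \<Otimes>\<^sub>M secret_source). real (nbits St x y)) / real n"

definition shannon_entropy :: "nat \<Rightarrow> bool list pmf \<Rightarrow> real" where
  "shannon_entropy n \<mu> = - (\<Sum>x\<in>words n. pmf \<mu> x * log 2 (pmf \<mu> x))"

text \<open>The first input bit selects encoder or decoder. The pair consisting of \<open>t\<close> and the output word
  \<open>x'\<close> is represented by the word \<open>1\<^sup>t 0 x'\<close>. The decoder has no access to the secret text, so its
  computation must not depend on \<open>y\<close>.\<close>

definition computes_stegosystem :: "machine \<Rightarrow> bool list \<Rightarrow> nat \<Rightarrow> stegosystem \<Rightarrow> bool" where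
  "computes_stegosystem U p n St \<longleftrightarrow>
     (\<forall>x\<in>words n. \<forall>y.
        U p (False # x) y = Some (replicate (nbits St x y) True @ False # stego_output St x y) \<and>
        U p (True # x) y = Some (dec St x))"

text \<open>The value is \<open>\<infinity>\<close> if no program computes the stegosystem, which is possible because \<open>t\<close> may
  depend on all of \<open>y\<close>.\<close>

definition kolmogorov :: "machine \<Rightarrow> nat \<Rightarrow> stegosystem \<Rightarrow> enat" where
  "kolmogorov U n St = (INF p\<in>{p. computes_stegosystem U p n St}. enat (length p))"

end

theory Submission imports Defs "HOL-Real_Asymp.Real_Asymp" begin

text \<open>\<open>P n\<close> is uniform on a half cube \<open>{(w \<in> F) # w | w}\<close>, which has entropy exactly \<open>n - 1\<close>.
  If a stegosystem has speed at least \<open>\<delta>\<close>, then from some covertext \<open>x\<close> in the support it reaches at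
  least \<open>2\<^sup>\<delta>\<^sup>n\<close> different outputs with positive probability, and perfect security forces all of them
  into the support. A fixed set of \<open>D\<close> words lies in at most a fraction \<open>2\<^sup>-\<^sup>D\<close> of all half cubes,
  while there are fewer than \<open>2\<^sup>L\<^sup>+\<^sup>1\<^sup>+\<^sup>n\<close> pairs of a program of length at most \<open>L\<close> and a covertext.
  Hence for \<open>L = 2\<^sup>\<delta>\<^sup>n\<^sup>/\<^sup>2\<close> and \<open>D = 2\<^sup>\<delta>\<^sup>n\<close> with \<open>n\<close> large, some half cube defeats all these stegosystems.\<close>

section \<open>Counting words and half cubes\<close>

lemma card_words: "card (words n) = 2 ^ n" and finite_words: "finite (words n)"
proof -
  have eq: "words n = {x. set x \<subseteq> (UNIV :: bool set) \<and> length x = n}"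
    by (auto simp: words_def)
  show "card (words n) = 2 ^ n"
    unfolding eq by (subst card_lists_length_eq) auto
  show "finite (words n)"
    unfolding eq by (rule finite_lists_length_eq) auto
qed

lemma card_words_le: "card {p :: bool list. length p \<le> L} < 2 ^ Suc L"
  and finite_words_le: "finite {p :: bool list. length p \<le> L}"
proof -
  have eq: "{p :: bool list. length p \<le> L} = {p. set p \<subseteq> UNIV \<and> length p \<le> L}"
    by auto
  have "(\<Sum>i\<le>L. (2::nat) ^ i) < 2 ^ Suc L"
    by (induction L) auto
  then show "card {p :: bool list. length p \<le> L} < 2 ^ Suc L"
    unfolding eq by (subst card_lists_length_le) auto
  show "finite {p :: bool list. length p \<le> L}"
    unfolding eq by (rule finite_lists_length_le) auto
qed

text \<open>The graph of the indicator function of \<open>F\<close>, with the value written in front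
  of the argument. A set of required words thus constrains \<open>F\<close> only at their
  tails.\<close>

definition half_cube :: "nat \<Rightarrow> bool list set \<Rightarrow> bool list set" where
  "half_cube m F = (\<lambda>w. (w \<in> F) # w) ` words m"

lemma half_cube_subset_words: "half_cube m F \<subseteq> words (Suc m)"
  by (auto simp: half_cube_def words_def)

lemma card_half_cube: "card (half_cube m F) = 2 ^ m"
  unfolding half_cube_def by (subst card_image) (auto simp: inj_on_def card_words)

lemma finite_half_cube: "finite (half_cube m F)" and half_cube_nonempty: "half_cube m F \<noteq> {}"
  using card_half_cube[of m F] by (auto intro: card_ge_0_finite)

lemma card_half_cubes_above:
  "card {F \<in> Pow (words m). N \<subseteq> half_cube m F} * 2 ^ card N \<le> 2 ^ 2 ^ m"
proof (cases "{F \<in> Pow (words m). N \<subseteq> half_cube m F} = {}")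
  case False
  then obtain F0 where F0: "N \<subseteq> half_cube m F0" by auto
  have tl_N: "tl ` N \<subseteq> words m" using F0 by (auto simp: half_cube_def words_def)
  have "inj_on tl N" by (rule inj_on_subset[OF _ F0]) (auto simp: half_cube_def inj_on_def)
  then have card_tl: "card (tl ` N) = card N" by (simp add: card_image)
  have "card {F \<in> Pow (words m). N \<subseteq> half_cube m F} \<le> card (Pow (words m - tl ` N))"
  proof (rule card_inj_on_le[where f = "\<lambda>F. F - tl ` N"])
    have mem_iff: "w \<in> F \<longleftrightarrow> True # w \<in> N"
      if "N \<subseteq> half_cube m F" "w \<in> tl ` N" for F w
      using that by (fastforce simp: half_cube_def)
    show "inj_on (\<lambda>F. F - tl ` N) {F \<in> Pow (words m). N \<subseteq> half_cube m F}"
    proof (rule inj_onI)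
      fix F G
      assume F: "F \<in> {F \<in> Pow (words m). N \<subseteq> half_cube m F}"
        and G: "G \<in> {F \<in> Pow (words m). N \<subseteq> half_cube m F}"
        and eq: "F - tl ` N = G - tl ` N"
      have "w \<in> F \<longleftrightarrow> w \<in> G" for w
        using mem_iff[of F w] mem_iff[of G w] F G eq by (cases "w \<in> tl ` N") auto
      then show "F = G" by blast
    qed
  qed (use finite_words in auto)
  also have "\<dots> = 2 ^ (2 ^ m - card N)"
    using tl_N finite_words finite_subset[OF tl_N finite_words]
    by (simp add: card_Pow card_Diff_subset card_words card_tl)
  finally have "card {F \<in> Pow (words m). N \<subseteq> half_cube m F} * 2 ^ card N
      \<le> 2 ^ (2 ^ m - card N) * 2 ^ card N" by simp
  moreover have "card N \<le> 2 ^ m"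
    using card_mono[OF finite_words tl_N] by (simp add: card_tl card_words)
  ultimately show ?thesis by (simp flip: power_add)
next
  case True
  then show ?thesis by (simp only:) simp
qed

text \<open>Union bound: each member of \<open>\<N>\<close> rules out at most a fraction
  \<open>2\<^sup>-\<^sup>D\<close> of the choices of \<open>F\<close>, and there are fewer than
  \<open>2 ^ D\<close> members.\<close>

lemma half_cube_avoiding:
  assumes "finite \<N>" and "card \<N> < 2 ^ D" and "\<And>N. N \<in> \<N> \<Longrightarrow> D \<le> card N"
  shows "\<exists>F. \<forall>N\<in>\<N>. \<not> N \<subseteq> half_cube m F"
proof (rule ccontr)
  assume *: "\<not> ?thesis"
  define bad where "bad N = {F \<in> Pow (words m). N \<subseteq> half_cube m F}" for N
  have card_bad: "card (bad N) * 2 ^ D \<le> 2 ^ 2 ^ m" if "N \<in> \<N>" for N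
  proof -
    have "card (bad N) * 2 ^ D \<le> card (bad N) * 2 ^ card N"
      using assms(3)[OF that] by (intro mult_left_mono power_increasing) auto
    then show ?thesis
      using card_half_cubes_above[of m N] unfolding bad_def by linarith
  qed
  have "Pow (words m) \<subseteq> (\<Union>N\<in>\<N>. bad N)"
    using * unfolding bad_def by blast
  then have "card (Pow (words m)) \<le> card (\<Union>N\<in>\<N>. bad N)"
    using assms(1) finite_words by (intro card_mono) (auto simp: bad_def)
  also have "\<dots> \<le> (\<Sum>N\<in>\<N>. card (bad N))"
    by (rule card_UN_le[OF assms(1)])
  finally have "2 ^ 2 ^ m * 2 ^ D \<le> (\<Sum>N\<in>\<N>. card (bad N) * 2 ^ D)"
    by (simp add: card_Pow finite_words card_words flip: sum_distrib_right)
  also have "\<dots> \<le> card \<N> * 2 ^ 2 ^ m"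
    using sum_bounded_above[of \<N> "\<lambda>N. card (bad N) * 2 ^ D" "2 ^ 2 ^ m"] card_bad by simp
  also have "\<dots> < 2 ^ D * 2 ^ 2 ^ m"
    using assms(2) by simp
  finally show False by (simp add: mult.commute)
qed

section \<open>Entropy of a uniform distribution\<close>

lemma shannon_entropy_pmf_of_set:
  assumes "S \<subseteq> words n" and "S \<noteq> {}"
  shows "shannon_entropy n (pmf_of_set S) = log 2 (card S)"
proof -
  have fin: "finite S" using assms(1) finite_words finite_subset by blast
  have "(\<Sum>x\<in>words n. pmf (pmf_of_set S) x * log 2 (pmf (pmf_of_set S) x))
      = (\<Sum>x\<in>S. pmf (pmf_of_set S) x * log 2 (pmf (pmf_of_set S) x))"
    using assms fin finite_words by (intro sum.mono_neutral_right) auto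
  also have "\<dots> = - log 2 (card S)"
    using assms fin by (simp add: log_divide card_gt_0_iff)
  finally show ?thesis by (simp add: shannon_entropy_def)
qed

section \<open>The secret source and the outputs it produces\<close>

interpretation secret: prob_space secret_source
  unfolding secret_source_def by (intro prob_space.prob_space_stream_space prob_space_measure_pmf)

lemma space_secret_source [simp]: "space secret_source = UNIV"
  by (simp add: secret_source_def space_stream_space)

lemma measurable_stake_secret [measurable]:
  "stake k \<in> secret_source \<rightarrow>\<^sub>M count_space UNIV"
proof -
  have "sets secret_source = sets (stream_space (count_space (UNIV :: bool set)))"
    unfolding secret_source_def by (rule sets_stream_space_cong) simp
  then show ?thesis
    using measurable_stake by (simp cong: measurable_cong_sets)
qed

lemma prob_prefix: "secret.prob {y. stake (length w) y = w} = (1/2) ^ length w"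
proof -
  have meas: "{y. stake (length w) y = w} \<in> sets secret_source" for w
    using measurable_sets[OF measurable_stake_secret, of "{w}" "length w"]
    by (simp add: vimage_def)
  have "emeasure secret_source {y. stake (length w) y = w} = ennreal ((1/2) ^ length w)"
  proof (induction w)
    case Nil
    then show ?case using secret.emeasure_space_1 by simp
  next
    case (Cons b w)
    have "emeasure secret_source {y. stake (length (b # w)) y = b # w}
       = (\<integral>\<^sup>+c. emeasure secret_source {y. c = b \<and> stake (length w) y = w} \<partial>bernoulli_pmf (1/2))"
      using prob_space.emeasure_stream_space[OF prob_space_measure_pmf, of "{y. stake (length (b # w)) y = b # w}"] meas[of "b # w"]
      by (simp add: secret_source_def space_stream_space)
    \<comment> \<open>For a fixed first bit \<open>c\<close> the event is empty unless
      \<open>c = b\<close>, when it is the event for the shorter prefix.\<close>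
    also have "\<dots> = (\<integral>\<^sup>+c. indicator {b} c * ennreal ((1/2) ^ length w) \<partial>bernoulli_pmf (1/2))"
      using Cons.IH by (intro nn_integral_cong) (auto simp: indicator_def)
    also have "\<dots> = ennreal (1/2) * ennreal ((1/2) ^ length w)"
      by (subst nn_integral_multc) (auto simp: emeasure_pmf_single)
    also have "\<dots> = ennreal ((1/2) ^ length (b # w))"
      by (subst ennreal_mult[symmetric]) auto
    finally show ?case .
  qed
  then show ?thesis by (simp add: measure_def)
qed

text \<open>Positive probability, rather than mere possibility, is required because perfect security
  says nothing about outputs that occur only on null sets.\<close>

definition reachable :: "stegosystem \<Rightarrow> bool list \<Rightarrow> bool list set" where
  "reachable St x = {x'. secret.prob {y. stego_output St x y = x'} > 0}"

section \<open>Speed and security in terms of reachable outputs\<close>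

context
  fixes n :: nat and St :: stegosystem
  assumes St: "is_stegosystem n St"
begin

lemma measurable_nbits [measurable]: "nbits St x \<in> secret_source \<rightarrow>\<^sub>M count_space UNIV"
  using St by (simp add: is_stegosystem_def)

lemma measurable_stego_output [measurable]:
  "stego_output St x \<in> secret_source \<rightarrow>\<^sub>M count_space UNIV"
  unfolding stego_output_def[abs_def] sent_bits_def
  \<comment> \<open>The prefix length depends on \<open>y\<close> but takes countably many values,
    so it may be treated as fixed.\<close>
  by (rule measurable_compose_countable[where g = "nbits St x"]) measurable

lemma stego_output_in_words: "x \<in> words n \<Longrightarrow> stego_output St x y \<in> words n"
  and dec_stego_output: "x \<in> words n \<Longrightarrow> dec St (stego_output St x y) = stake (nbits St x y) y"
  using St by (auto simp: is_stegosystem_def sent_bits_def)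

text \<open>Correct decoding makes \<open>t\<close> a function of the output alone. Hence, for fixed
  \<open>x\<close>, it takes finitely many values and is integrable.\<close>

lemma nbits_eq: "x \<in> words n \<Longrightarrow> nbits St x y = length (dec St (stego_output St x y))"
  by (simp add: dec_stego_output)

lemma reachable_subset_words: "x \<in> words n \<Longrightarrow> reachable St x \<subseteq> words n"
proof
  fix x' assume x: "x \<in> words n" and "x' \<in> reachable St x"
  then have "{y. stego_output St x y = x'} \<noteq> {}" by (auto simp: reachable_def simp del: Collect_empty_eq)
  then show "x' \<in> words n" using stego_output_in_words[OF x] by auto
qed

text \<open>Each output \<open>x'\<close> contributes at most \<open>1\<close> to the expectation of \<open>2\<^sup>t\<close>, because it is only
  sent if \<open>y\<close> starts with \<open>dec St x'\<close>; Jensen's inequality turns this into a bound on the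
  expectation of \<open>t\<close>.\<close>

lemma powr_expectation_nbits_le_card_reachable:
  assumes x: "x \<in> words n"
  shows "2 powr (secret.expectation (\<lambda>y. real (nbits St x y))) \<le> card (reachable St x)"
proof -
  define len where "len x' = length (dec St x')" for x'
  define pr where "pr x' = secret.prob {y. stego_output St x y = x'}" for x'
  have meas: "{y. stego_output St x y = x'} \<in> sets secret_source" for x'
    using measurable_sets[OF measurable_stego_output, of "{x'}" x] by (simp add: vimage_def)
  have fin: "finite ((\<lambda>y. stego_output St x y) ` UNIV)"
    by (rule finite_subset[OF _ finite_words[of n]]) (use stego_output_in_words[OF x] in auto)
  \<comment> \<open>As outputs range over the finite set \<open>words n\<close>, any function of the
    output is a finite combination of indicators; this gives both integrability and the expectation
    as a sum.\<close>
  have sum_eq: "g (stego_output St x y)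
      = (\<Sum>x'\<in>words n. g x' * indicator {y. stego_output St x y = x'} y)" for g :: "_ \<Rightarrow> real" and y
    using stego_output_in_words[OF x, of y] finite_words
    by (simp add: indicator_def of_bool_def if_distrib[of "(*) _"] sum.delta' cong: if_cong)
  have int: "integrable secret_source (\<lambda>y. g (stego_output St x y))" for g :: "_ \<Rightarrow> real"
    unfolding sum_eq[of g] using meas
    by (intro Bochner_Integration.integrable_sum integrable_mult_right) (auto intro!: secret.integrable_const_bound[where B = 1])
  have conv: "convex_on UNIV (\<lambda>u::real. 2 powr u)"
  proof -
    have "convex_on UNIV (\<lambda>u::real. exp (ln 2 * u))"
      by (rule convex_on_exp) auto
    then show ?thesis by (simp add: powr_def mult.commute)
  qed
  have "2 powr (secret.expectation (\<lambda>y. real (nbits St x y)))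
      \<le> secret.expectation (\<lambda>y. 2 powr real (nbits St x y))"
    using int[of "\<lambda>x'. real (len x')"] int[of "\<lambda>x'. 2 powr real (len x')"]
    by (intro secret.jensens_inequality[where I = UNIV] conv)
       (auto simp: nbits_eq[OF x] len_def)
  also have "\<dots> = secret.expectation (\<lambda>y. (2::real) ^ len (stego_output St x y))"
    by (simp add: nbits_eq[OF x] len_def powr_realpow)
  also have "\<dots> = (\<Sum>x'\<in>words n. 2 ^ len x' * pr x')"
    unfolding sum_eq[of "\<lambda>x'. 2 ^ len x'"] pr_def using meas
    by (subst Bochner_Integration.integral_sum) (auto intro!: secret.integrable_const_bound[where B = 1])
  also have "\<dots> = (\<Sum>x'\<in>reachable St x. 2 ^ len x' * pr x')"
    using finite_words reachable_subset_words[OF x]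
    by (intro sum.mono_neutral_right) (auto simp: reachable_def pr_def zero_less_measure_iff)
  also have "\<dots> \<le> (\<Sum>x'\<in>reachable St x. 1)"
  proof (rule sum_mono)
    fix x'
    have "pr x' \<le> secret.prob {y. stake (length (dec St x')) y = dec St x'}"
      unfolding pr_def
      using measurable_sets[OF measurable_stake_secret, of "{dec St x'}" "length (dec St x')"]
      by (intro secret.finite_measure_mono) (auto simp: vimage_def dec_stego_output[OF x])
    then have "2 ^ len x' * pr x' \<le> 2 ^ len x' * (1/2) ^ len x'"
      by (intro mult_left_mono) (simp_all add: prob_prefix len_def)
    then show "2 ^ len x' * pr x' \<le> (1::real)"
      by (simp flip: power_mult_distrib)
  qed
  finally show ?thesis by simp
qed

lemma measurable_stego_output_pair:
  "(\<lambda>(x, y). stego_output St x y) \<in> measure_pmf \<mu> \<Otimes>\<^sub>M secret_source \<rightarrow>\<^sub>M count_space UNIV"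
proof -
  have "(\<lambda>(x, y). stego_output St x y) \<in> count_space UNIV \<Otimes>\<^sub>M secret_source \<rightarrow>\<^sub>M count_space UNIV"
    by (rule measurable_pair_measure_countable1) (auto simp: measurable_stego_output)
  moreover have "sets (measure_pmf \<mu> \<Otimes>\<^sub>M secret_source) = sets (count_space UNIV \<Otimes>\<^sub>M secret_source)"
    by (rule sets_pair_measure_cong) auto
  ultimately show ?thesis by (simp cong: measurable_cong_sets)
qed

text \<open>The single covertext \<open>x\<close> already contributes a positive product to the
  probability of output \<open>x'\<close>, and security equates that probability with
  \<open>pmf \<mu> x'\<close>.\<close>

lemma reachable_subset_set_pmf:
  assumes secure: "perfectly_secure n \<mu> St" and x: "x \<in> words n" "x \<in> set_pmf \<mu>"
  shows "reachable St x \<subseteq> set_pmf \<mu>"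
proof
  interpret pair_prob_space "measure_pmf \<mu>" secret_source ..
  fix x' assume x': "x' \<in> reachable St x"
  have meas: "{y. stego_output St x y = x'} \<in> sets secret_source"
    using measurable_sets[OF measurable_stego_output, of "{x'}" x] by (simp add: vimage_def)
  have meas': "{(x, y). stego_output St x y = x'} \<in> sets (measure_pmf \<mu> \<Otimes>\<^sub>M secret_source)"
    using measurable_sets[OF measurable_stego_output_pair, of "{x'}" \<mu>]
    by (simp add: vimage_def space_pair_measure case_prod_unfold)
  have "0 < pmf \<mu> x * secret.prob {y. stego_output St x y = x'}"
    using x' x(2) by (simp add: reachable_def pmf_positive)
  also have "\<dots> = measure (measure_pmf \<mu> \<Otimes>\<^sub>M secret_source) ({x} \<times> {y. stego_output St x y = x'})"
    using meas by (simp add: measure_def secret.emeasure_pair_measure_Times enn2real_mult pmf.rep_eq)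
  also have "\<dots> \<le> measure (measure_pmf \<mu> \<Otimes>\<^sub>M secret_source) {(x, y). stego_output St x y = x'}"
    using meas' by (intro finite_measure_mono) auto
  also have "\<dots> = pmf \<mu> x'"
    using secure reachable_subset_words[OF x(1)] x' by (auto simp: perfectly_secure_def)
  finally show "x' \<in> set_pmf \<mu>" by (simp add: set_pmf_iff)
qed

lemma exists_word_expectation_nbits_ge:
  assumes "speed n \<mu> St \<ge> \<delta>" and "\<delta> > 0" and "n > 0"
  shows "\<exists>x\<in>set_pmf \<mu>. secret.expectation (\<lambda>y. real (nbits St x y)) \<ge> \<delta> * n"
proof (rule ccontr)
  interpret pair_prob_space "measure_pmf \<mu>" secret_source ..
  let ?E = "\<lambda>x. secret.expectation (\<lambda>y. real (nbits St x y))"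
  assume *: "\<not> ?thesis"
  then have less: "?E x < \<delta> * n" if "x \<in> set_pmf \<mu>" for x
    using that * by force
  let ?I = "LINT (x, y)|(measure_pmf \<mu> \<Otimes>\<^sub>M secret_source). real (nbits St x y)"
  have I: "?I \<ge> \<delta> * n"
    using assms by (simp add: speed_def field_simps)
  \<comment> \<open>A non-integrable function has integral 0 by convention, so the positive lower
    bound itself forces integrability, as needed for Fubini.\<close>
  then have int: "integrable (measure_pmf \<mu> \<Otimes>\<^sub>M secret_source) (\<lambda>(x, y). real (nbits St x y))"
    using not_integrable_integral_eq assms mult_pos_pos[of \<delta> "real n"] by fastforce
  have "?I = measure_pmf.expectation \<mu> ?E"
    using integral_fst'[OF int] by simp
  moreover have "measure_pmf.expectation \<mu> ?E < \<delta> * n"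
    using integrable_fst'[OF int] less
    by (intro measure_pmf.expectation_less) (auto simp: AE_measure_pmf_iff)
  ultimately show False using I by simp
qed

end

section \<open>Programs and the reachable sets they determine\<close>

lemma reachable_cong:
  assumes "\<And>y. stego_output St x y = stego_output St' x y"
  shows "reachable St x = reachable St' x"
  by (simp add: reachable_def assms)

text \<open>The code word \<open>1\<^sup>t 0 x'\<close> determines \<open>x'\<close>, so a program
  fixes the reachable sets. This lets programs be counted in place of stegosystems.\<close>

lemma reachable_eq_if_computes:
  assumes "computes_stegosystem U p n St" "computes_stegosystem U p n St'" and "x \<in> words n"
  shows "reachable St x = reachable St' x"
proof (rule reachable_cong)
  fix y
  have "replicate (nbits St x y) True @ False # stego_output St x y
      = replicate (nbits St' x y) True @ False # stego_output St' x y"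
    using assms by (fastforce simp: computes_stegosystem_def)
  \<comment> \<open>Removing the leading ones and then the separating zero recovers the
    output.\<close>
  from arg_cong[OF this, of "\<lambda>v. tl (dropWhile id v)"]
  show "stego_output St x y = stego_output St' x y"
    by (simp add: dropWhile_append)
qed

text \<open>A finite infimum comes from a nonempty set of lengths and is attained, since
  \<open>enat\<close> is well-ordered.\<close>

lemma kolmogorov_program:
  assumes "kolmogorov U n St \<noteq> \<infinity>"
  obtains p where "computes_stegosystem U p n St" "length p = the_enat (kolmogorov U n St)"
proof -
  let ?A = "(\<lambda>p. enat (length p)) ` {p. computes_stegosystem U p n St}"
  have "{p. computes_stegosystem U p n St} \<noteq> {}"
    using assms by (force simp: kolmogorov_def top_enat_def)
  then have "Inf ?A \<in> ?A"
    by (auto simp: Inf_enat_def intro: LeastI)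
  then obtain p where "computes_stegosystem U p n St" "kolmogorov U n St = enat (length p)"
    by (auto simp: kolmogorov_def)
  then show thesis using that by simp
qed

text \<open>There are fewer than \<open>2 ^ Suc L * 2 ^ Suc m \<le> 2 ^ D\<close> pairs of program
  and covertext, so one \<open>F\<close> avoids all their large reachable sets at once. The choice
  of \<open>F\<close> thus precedes that of the stegosystem.\<close>

lemma exists_half_cube_not_containing_reachable:
  assumes "Suc L + Suc m \<le> D"
  shows "\<exists>F. \<forall>p St. \<forall>x\<in>words (Suc m). length p \<le> L \<longrightarrow> computes_stegosystem U p (Suc m) St \<longrightarrow>
    D \<le> card (reachable St x) \<longrightarrow> \<not> reachable St x \<subseteq> half_cube m F"
proof -
  define n where "n = Suc m"
  \<comment> \<open>Any stegosystem computed by \<open>p\<close> yields the same set. A program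
    computing none contributes an arbitrary set, which leaves the bound on the number of sets
    intact.\<close>
  define R where "R = (\<lambda>(p, x). reachable (SOME St. computes_stegosystem U p n St) x)"
  define \<N> where "\<N> = {N \<in> R ` ({p. length p \<le> L} \<times> words n). D \<le> card N}"
  have fin: "finite ({p :: bool list. length p \<le> L} \<times> words n)"
    using finite_words finite_words_le by simp
  have "card \<N> \<le> card (R ` ({p. length p \<le> L} \<times> words n))"
    using fin by (intro card_mono) (auto simp: \<N>_def)
  also have "\<dots> \<le> card ({p :: bool list. length p \<le> L} \<times> words n)"
    by (rule card_image_le[OF fin])
  also have "\<dots> < 2 ^ Suc L * 2 ^ n"
    using card_words_le by (simp add: card_cartesian_product card_words)
  also have "\<dots> \<le> 2 ^ D"
    using assms by (simp add: n_def flip: power_add del: power_Suc)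
  finally have "card \<N> < 2 ^ D" .
  moreover have "finite \<N>"
    unfolding \<N>_def using fin by (intro finite_Collect_conjI disjI1) simp
  moreover have "D \<le> card N" if "N \<in> \<N>" for N
    using that by (simp add: \<N>_def)
  ultimately obtain F where F: "\<forall>N\<in>\<N>. \<not> N \<subseteq> half_cube m F"
    using half_cube_avoiding[of \<N> D m] by blast
  have "\<not> reachable St x \<subseteq> half_cube m F"
    if "x \<in> words n" "length p \<le> L" "computes_stegosystem U p n St" "D \<le> card (reachable St x)"
    for p St x
  proof -
    have "reachable St x = R (p, x)"
      unfolding R_def prod.case
      by (rule reachable_eq_if_computes[OF that(3) _ that(1)])
        (rule someI[where P = "\<lambda>St. computes_stegosystem U p n St", OF that(3)])
    then have "reachable St x \<in> \<N>"
      unfolding \<N>_def using that by blast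
    then show ?thesis using F by blast
  qed
  then show ?thesis unfolding n_def by blast
qed


section \<open>Choice of the distributions and the final contradiction\<close>

theorem theorem1:
  fixes U :: machine and \<delta> :: real
  assumes "universal_machine U" and "\<delta> > 0"
  shows "\<exists>P :: nat \<Rightarrow> bool list pmf.
    (\<forall>n. set_pmf (P n) \<subseteq> words n \<and> shannon_entropy n (P n) \<ge> real n - 1) \<and>
    (\<forall>St :: nat \<Rightarrow> stegosystem.
       (\<forall>n. is_stegosystem n (St n)) \<longrightarrow>
       (\<forall>\<^sub>F n in sequentially. kolmogorov U n (St n) \<noteq> \<infinity>) \<longrightarrow>
       (\<lambda>n. log 2 (real (the_enat (kolmogorov U n (St n))))) \<in> o(\<lambda>n. real n) \<longrightarrow>
       (\<forall>n\<ge>1. speed n (P n) (St n) \<ge> \<delta>) \<longrightarrow>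
       (\<forall>\<^sub>F n in sequentially. \<not> perfectly_secure n (P n) (St n)))"
proof -
  \<comment> \<open>Any rate strictly between 0 and \<delta> would serve in place of
    \<open>\<delta> / 2\<close>: being positive it dominates \<open>log K = o(n)\<close>, and being
    below \<delta> it makes \<open>Suc (L n) + n \<le> D n\<close> eventually true.\<close>
  define L where "L n = nat \<lfloor>2 powr (\<delta> / 2 * n)\<rfloor>" for n :: nat
  define D where "D n = nat \<lceil>2 powr (\<delta> * n)\<rceil>" for n :: nat
  define good where "good m F \<longleftrightarrow> (\<forall>p St. \<forall>x\<in>words (Suc m). length p \<le> L (Suc m) \<longrightarrow>
    computes_stegosystem U p (Suc m) St \<longrightarrow> D (Suc m) \<le> card (reachable St x) \<longrightarrow>
    \<not> reachable St x \<subseteq> half_cube m F)" for m F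
  \<comment> \<open>A good \<open>F\<close> is secured only for large \<open>m\<close>. Elsewhere
    the choice may be arbitrary, since the entropy bound holds for every half cube. For
    \<open>n = 0\<close> the empty word has entropy 0.\<close>
  define S where "S m = half_cube m (SOME F. good m F)" for m
  define P where "P n = (case n of 0 \<Rightarrow> return_pmf [] | Suc m \<Rightarrow> pmf_of_set (S m))" for n
  have S: "S m \<subseteq> words (Suc m)" "S m \<noteq> {}" "finite (S m)" "card (S m) = 2 ^ m" for m
    unfolding S_def
    by (rule half_cube_subset_words half_cube_nonempty finite_half_cube card_half_cube)+
  have P_Suc: "set_pmf (P (Suc m)) = S m" for m
    using S[of m] by (simp add: P_def)

  have P: "set_pmf (P n) \<subseteq> words n \<and> shannon_entropy n (P n) \<ge> real n - 1" for n
  proof (cases n)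
    case 0
    then show ?thesis
      by (simp add: P_def shannon_entropy_def words_def)
  next
    case (Suc m)
    have "shannon_entropy n (P n) = m"
      using shannon_entropy_pmf_of_set[OF S(1,2), of m] S(4)[of m]
      by (simp add: Suc P_def log_nat_power)
    then show ?thesis
      using S(1)[of m] P_Suc[of m] by (simp add: Suc)
  qed

  have "\<forall>\<^sub>F n::nat in sequentially. 2 powr (\<delta> / 2 * n) + 1 + n \<le> 2 powr (\<delta> * n)"
    using \<open>\<delta> > 0\<close> by real_asymp
  then have ev_LD: "\<forall>\<^sub>F n in sequentially. Suc (L n) + n \<le> D n"
  proof eventually_elim
    case (elim n)
    have "real (L n) \<le> 2 powr (\<delta> / 2 * n)" "2 powr (\<delta> * n) \<le> real (D n)"
      by (simp_all add: L_def D_def)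
    with elim have "real (Suc (L n) + n) \<le> real (D n)" by simp
    then show ?case by (simp only: of_nat_le_iff)
  qed

  have "\<forall>\<^sub>F n in sequentially. \<not> perfectly_secure n (P n) (St n)"
    if St: "\<And>n. is_stegosystem n (St n)"
      and ev_K: "\<forall>\<^sub>F n in sequentially. kolmogorov U n (St n) \<noteq> \<infinity>"
      and K: "(\<lambda>n. log 2 (real (the_enat (kolmogorov U n (St n))))) \<in> o(\<lambda>n. real n)"
      and speed: "\<And>n. n \<ge> 1 \<Longrightarrow> speed n (P n) (St n) \<ge> \<delta>"
    for St
  proof -
    have "\<forall>\<^sub>F n in sequentially.
        norm (log 2 (real (the_enat (kolmogorov U n (St n))))) \<le> \<delta> / 2 * norm (real n)"
      by (rule landau_o.smallD[OF K]) (use \<open>\<delta> > 0\<close> in simp)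
    from this ev_K ev_LD eventually_gt_at_top[of 0] show ?thesis
    proof eventually_elim
      case (elim n)
      then obtain m where n: "n = Suc m" by (cases n) auto
      obtain p where p: "computes_stegosystem U p n (St n)"
          and len: "length p = the_enat (kolmogorov U n (St n))"
        using kolmogorov_program elim(2) by blast
      have "real (length p) \<le> 2 powr (\<delta> / 2 * n)"
      \<comment> \<open>The empty program is separated because \<open>2 powr log 2 k = k\<close>
        fails at \<open>k = 0\<close>.\<close>
      proof (cases "length p = 0")
        case False
        then have "real (length p) = 2 powr log 2 (length p)" by simp
        also have "\<dots> \<le> 2 powr (\<delta> / 2 * n)"
          using elim(1) len by (intro powr_mono) auto
        finally show ?thesis .
      qed simp
      then have p_le: "length p \<le> L n" by (simp add: L_def le_nat_floor)
      have "\<exists>F. good m F"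
        unfolding good_def
        by (rule exists_half_cube_not_containing_reachable) (use elim(3) n in simp)
      then have good: "good m (SOME F. good m F)" by (rule someI_ex)
      show ?case
      proof
        assume secure: "perfectly_secure n (P n) (St n)"
        obtain x where x: "x \<in> set_pmf (P n)"
            and E: "\<delta> * n \<le> secret.expectation (\<lambda>y. real (nbits (St n) x y))"
          using exists_word_expectation_nbits_ge[OF St speed \<open>\<delta> > 0\<close>, of n] elim(4) by auto
        have xw: "x \<in> words n" using x P by blast
        have "2 powr (\<delta> * n) \<le> 2 powr secret.expectation (\<lambda>y. real (nbits (St n) x y))"
          using E by simp
        also have "\<dots> \<le> card (reachable (St n) x)"
          by (rule powr_expectation_nbits_le_card_reachable[OF St xw])
        finally have "D n \<le> card (reachable (St n) x)"
          by (simp add: D_def ceiling_le_iff nat_le_iff)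
        then have "\<not> reachable (St n) x \<subseteq> S m"
          using good p p_le xw unfolding good_def S_def n by blast
        then show False
          using reachable_subset_set_pmf[OF St secure xw x] P_Suc[of m] by (simp add: n)
      qed
    qed
  qed
  with P show ?thesis by blast
qed

end
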